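(* Let $\mathbf P=(P,\le)$ be a poset satisfying the Ascending Chain Condition. For $a\in P$ let $f_a\colon P\to A(\mathbf P)$ be the mapping defined by $f_a(x):=\operatorname{Max} L(a,x)$ for all $x\in P$. Then the mapping $a\mapsto f_a$ is an isomorphic embedding of $\mathbf P$ into the poset $\big((A(\mathbf P))^P,\le\big)$ of all mappings from $P$ to $A(\mathbf P)$; that is, $a\mapsto f_a$ is injective and, for all $a,b\in P$, $a\le b$ if and only if $f_a\le f_b$ (so $\mathbf P$ is isomorphic to the subposet $(\{f_a\mid a\in P\},\le)$).
   Context: Let $\mathbf P=(P,\le)$ be a poset. An antichain of $\mathbf P$ is a subset of $P$ (possibly empty) in which any two distinct elements are incomparable; $A(\mathbf P)$ denotes the set of all antichains of $\mathbf P$. For subsets $B,C$ of $P$ one defines $B\le C$ if for every $x\in B$ there exists some $y\in C$ with $x\le y$. The restriction of this relation to $A(\mathbf P)$ is a partial order, and $(A(\mathbf P))^P$, the set of all mappings from $P$ to $A(\mathbf P)$, is ordered pointwise: $f\le g$ iff $f(x)\le g(x)$ for all $x\in P$. For $B\subseteq P$, $\operatorname{Max} B$ denotes the set of all maximal elements of $B$ (this is always an antichain of $\mathbf P$). For $a,b\in P$ the lower cone is $L(a,b):=\{x\in P\mid x\le a\text{ and }x\le b\}$. $\mathbf P$ satisfies the Ascending Chain Condition if it has no infinite (strictly) ascending chains $x_1<x_2<x_3<\cdots$. *)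

theory Defs
  imports Main
begin

definition is_antichain :: "'a::order set \<Rightarrow> bool" where
  "is_antichain A \<longleftrightarrow> (\<forall>x\<in>A. \<forall>y\<in>A. x \<noteq> y \<longrightarrow> \<not> x \<le> y \<and> \<not> y \<le> x)"

definition set_le :: "'a::order set \<Rightarrow> 'a set \<Rightarrow> bool" where
  "set_le B C \<longleftrightarrow> (\<forall>x\<in>B. \<exists>y\<in>C. x \<le> y)"

definition maximal_elements :: "'a::order set \<Rightarrow> 'a set" where
  "maximal_elements B = {x \<in> B. \<not> (\<exists>y\<in>B. x < y)}"

definition lower_cone :: "'a::order \<Rightarrow> 'a \<Rightarrow> 'a set" where
  "lower_cone a b = {x. x \<le> a \<and> x \<le> b}"

lemma is_antichain_maximal_elements: "is_antichain (maximal_elements B)"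
  by (auto simp: is_antichain_def maximal_elements_def order.order_iff_strict)

lemma set_le_refl: "set_le B B"
  by (auto simp: set_le_def)

lemma set_le_trans: "set_le A B \<Longrightarrow> set_le B C \<Longrightarrow> set_le A C"
  unfolding set_le_def by (meson order_trans)

lemma antichain_subset_if_set_le:
  assumes "is_antichain B" "set_le B C" "set_le C B"
  shows "B \<subseteq> C"
proof
  fix x assume x: "x \<in> B"
  obtain y where y: "y \<in> C" "x \<le> y"
    using assms(2) x by (auto simp: set_le_def)
  obtain z where z: "z \<in> B" "y \<le> z"
    using assms(3) y(1) by (auto simp: set_le_def)
  have "x = z"
    using assms(1) x z(1) order_trans[OF y(2) z(2)] by (auto simp: is_antichain_def)
  with y z show "x \<in> C" by auto
qed

text \<open>
  The poset of all antichains is a type of its own, so that the order on the mappings into it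
  is the pointwise order that the library puts on function spaces.
\<close>

typedef (overloaded) 'a antichain = "{A :: 'a::order set. is_antichain A}"
  morphisms elements Antichain
proof
  show "{} \<in> {A :: 'a set. is_antichain A}" by (simp add: is_antichain_def)
qed

setup_lifting type_definition_antichain

instantiation antichain :: (order) order
begin

lift_definition less_eq_antichain :: "'a antichain \<Rightarrow> 'a antichain \<Rightarrow> bool" is set_le .

definition less_antichain :: "'a antichain \<Rightarrow> 'a antichain \<Rightarrow> bool" where
  "less_antichain A B \<longleftrightarrow> A \<le> B \<and> \<not> B \<le> A"

instance
proof
  fix A B C :: "'a antichain"
  show "A < B \<longleftrightarrow> A \<le> B \<and> \<not> B \<le> A" by (rule less_antichain_def)
  show "A \<le> A" by transfer (rule set_le_refl)
  show "A \<le> B \<Longrightarrow> B \<le> C \<Longrightarrow> A \<le> C" by transfer (rule set_le_trans)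
  show "A \<le> B \<Longrightarrow> B \<le> A \<Longrightarrow> A = B"
    by transfer (auto dest: antichain_subset_if_set_le)
qed

end

lift_definition Max_antichain :: "'a::order set \<Rightarrow> 'a antichain" is maximal_elements
  by (rule is_antichain_maximal_elements)

definition cone_map :: "'a::order \<Rightarrow> 'a \<Rightarrow> 'a antichain" where
  "cone_map a = (\<lambda>x. Max_antichain (lower_cone a x))"

end

theory Submission
  imports Defs
begin

text \<open>
  The element \<open>a\<close> can be recovered from its cone map, because \<open>L(a,a)\<close> has greatest element \<open>a\<close>,
  so that \<open>f\<^sub>a(a) = {a}\<close>. Comparing \<open>f\<^sub>a\<close> and \<open>f\<^sub>b\<close> at the single argument \<open>a\<close> therefore yields
  an element of \<open>L(b,a)\<close> above \<open>a\<close>, which gives \<open>a \<le> b\<close>. Conversely, if \<open>a \<le> b\<close>, then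
  \<open>L(a,x) \<subseteq> L(b,x)\<close> for every \<open>x\<close>. The passage from cones to their maximal elements preserves
  this inclusion as an inequality of antichains: under the Ascending Chain Condition every element
  of a set lies below a maximal element of that set. Injectivity follows from antisymmetry.
\<close>

text \<open>
  The Ascending Chain Condition says that the converse of the strict order is well-founded, so the
  elements of \<open>B\<close> above \<open>x\<close> include one with nothing of \<open>B\<close> above it.
\<close>
lemma maximal_element_above:
  fixes x :: "'a::order"
  assumes acc: "\<nexists>c :: nat \<Rightarrow> 'a. \<forall>n. c n < c (Suc n)" and "x \<in> B"
  shows "\<exists>m\<in>maximal_elements B. x \<le> m"
proof -
  have "wf {(y, x :: 'a). x < y}"
    using acc by (simp add: wf_iff_no_infinite_down_chain)
  moreover have "x \<in> {y \<in> B. x \<le> y}"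
    using \<open>x \<in> B\<close> by simp
  ultimately obtain m where m: "m \<in> {y \<in> B. x \<le> y}"
    and max: "\<And>y. (y, m) \<in> {(y, x). x < y} \<Longrightarrow> y \<notin> {y \<in> B. x \<le> y}"
    by (rule wfE_min) blast
  have "m \<in> maximal_elements B"
    using m max by (auto simp: maximal_elements_def dest: order.trans[OF _ less_imp_le])
  with m show ?thesis by blast
qed

lemma Max_antichain_mono:
  fixes B C :: "'a::order set"
  assumes acc: "\<nexists>c :: nat \<Rightarrow> 'a. \<forall>n. c n < c (Suc n)" and "B \<subseteq> C"
  shows "Max_antichain B \<le> Max_antichain C"
  unfolding less_eq_antichain.rep_eq Max_antichain.rep_eq set_le_def
proof
  fix x assume "x \<in> maximal_elements B"
  then have "x \<in> C" using \<open>B \<subseteq> C\<close> by (auto simp: maximal_elements_def)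
  with acc show "\<exists>y\<in>maximal_elements C. x \<le> y" by (rule maximal_element_above)
qed

lemma maximal_elements_lower_cone_self: "maximal_elements (lower_cone a a) = {a}"
  by (auto simp: maximal_elements_def lower_cone_def order.order_iff_strict)

lemma le_if_cone_map_le_at_self:
  assumes "cone_map a a \<le> cone_map b a"
  shows "a \<le> b"
proof -
  have "set_le {a} (maximal_elements (lower_cone b a))"
    using assms by (simp add: cone_map_def less_eq_antichain.rep_eq Max_antichain.rep_eq
        maximal_elements_lower_cone_self)
  then show ?thesis
    by (auto simp: set_le_def maximal_elements_def lower_cone_def)
qed

theorem theorem2:
  assumes "\<nexists>c :: nat \<Rightarrow> 'a::order. \<forall>n. c n < c (Suc n)"
  shows "inj (cone_map :: 'a \<Rightarrow> 'a \<Rightarrow> 'a antichain) \<and>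
    (\<forall>a b :: 'a. a \<le> b \<longleftrightarrow> cone_map a \<le> cone_map b)"
proof -
  have iff: "a \<le> b \<longleftrightarrow> cone_map a \<le> cone_map b" for a b :: 'a
  proof
    assume "a \<le> b"
    then have "lower_cone a x \<subseteq> lower_cone b x" for x
      by (auto simp: lower_cone_def)
    then show "cone_map a \<le> cone_map b"
      by (simp add: cone_map_def le_fun_def Max_antichain_mono[OF assms])
  next
    assume "cone_map a \<le> cone_map b"
    then have "cone_map a a \<le> cone_map b a"
      by (rule le_funD)
    then show "a \<le> b"
      by (rule le_if_cone_map_le_at_self)
  qed
  then have "inj (cone_map :: 'a \<Rightarrow> 'a \<Rightarrow> 'a antichain)"
    by (intro injI order.antisym) simp_all
  with iff show ?thesis by blast
qed

end
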